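(* For $i=1,2$ let $G_i\subseteq U(n_i)$ be a finite unitary reflection group and $E_i\subseteq\mathbb C^{n_i}$ a good bounded $G_i$-invariant domain. Then $E_1\times E_2\subseteq\mathbb C^{n_1}\times\mathbb C^{n_2}$ is a good $(G_1\times G_2)$-invariant domain, where $G_1\times G_2=\{g_1\oplus g_2: g_i\in G_i\}\subseteq U(n_1+n_2)$.
   Context: A reflection is an element of $U(n)$ of finite order whose fixed point set is a hyperplane (its reflecting hyperplane); a finite unitary reflection group $G$ is a finite subgroup of $U(n)$ generated by reflections; $\mathcal R_G$ is its set of reflecting hyperplanes. A bounded $G$-invariant domain $E$ is good if for every $Y\in\mathcal R_G$, $Y\cap E$ is connected and $Y\cap bE=b_Y(Y\cap E)$, where $b_Y$ denotes the topological boundary relative to $Y$. *)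

theory Defs
  imports "HOL-Analysis.Analysis"
begin

type_synonym 'n cmat = "complex^'n^'n"

definition ctrans :: "('n::finite) cmat \<Rightarrow> 'n cmat" where
  "ctrans A = (\<chi> i j. cnj (A $ j $ i))"

definition unitary :: "('n::finite) cmat \<Rightarrow> bool" where
  "unitary A \<longleftrightarrow> A ** ctrans A = mat 1"

definition fixset :: "('n::finite) cmat \<Rightarrow> (complex^'n) set" where
  "fixset A = {x. A *v x = x}"

text \<open>Complex hyperplane through the origin: kernel of a nonzero complex linear functional.\<close>
definition chyperplane :: "(complex^('n::finite)) set \<Rightarrow> bool" where
  "chyperplane Y \<longleftrightarrow> (\<exists>a. a \<noteq> 0 \<and> Y = {x. (\<Sum>i\<in>UNIV. a $ i * x $ i) = 0})"

definition reflection :: "('n::finite) cmat \<Rightarrow> bool" where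
  "reflection A \<longleftrightarrow> unitary A \<and> (\<exists>k>0. ((*v) A ^^ k) = id) \<and> chyperplane (fixset A)"

inductive_set mat_gen :: "('n::finite) cmat set \<Rightarrow> 'n cmat set" for S where
  one: "mat 1 \<in> mat_gen S"
| base: "A \<in> S \<Longrightarrow> A \<in> mat_gen S"
| mult: "A \<in> mat_gen S \<Longrightarrow> B \<in> mat_gen S \<Longrightarrow> A ** B \<in> mat_gen S"
| inv: "A \<in> mat_gen S \<Longrightarrow> matrix_inv A \<in> mat_gen S"

definition finite_unitary_reflection_group :: "('n::finite) cmat set \<Rightarrow> bool" where
  "finite_unitary_reflection_group G \<longleftrightarrow>
     finite G \<and> (\<forall>g\<in>G. unitary g) \<and> G = mat_gen {g\<in>G. reflection g}"

definition reflecting_hyperplanes :: "('n::finite) cmat set \<Rightarrow> (complex^'n) set set" where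
  "reflecting_hyperplanes G = {fixset g | g. g \<in> G \<and> reflection g}"

definition domain :: "(complex^('n::finite)) set \<Rightarrow> bool" where
  "domain E \<longleftrightarrow> open E \<and> connected E \<and> E \<noteq> {}"

definition invariant :: "('n::finite) cmat set \<Rightarrow> (complex^'n) set \<Rightarrow> bool" where
  "invariant G E \<longleftrightarrow> (\<forall>g\<in>G. (*v) g ` E = E)"

definition good :: "('n::finite) cmat set \<Rightarrow> (complex^'n) set \<Rightarrow> bool" where
  "good G E \<longleftrightarrow> bounded E \<and> domain E \<and> invariant G E \<and>
     (\<forall>Y\<in>reflecting_hyperplanes G. connected (Y \<inter> E) \<and>
        Y \<inter> frontier E = (subtopology euclidean Y) frontier_of (Y \<inter> E))"

definition block_diag :: "('n::finite) cmat \<Rightarrow> ('m::finite) cmat \<Rightarrow> ('n + 'm) cmat" where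
  "block_diag A B = (\<chi> i j. case (i, j) of
       (Inl a, Inl b) \<Rightarrow> A $ a $ b
     | (Inr a, Inr b) \<Rightarrow> B $ a $ b
     | _ \<Rightarrow> 0)"

definition prod_group :: "('n::finite) cmat set \<Rightarrow> ('m::finite) cmat set \<Rightarrow> ('n + 'm) cmat set" where
  "prod_group G1 G2 = {block_diag g1 g2 | g1 g2. g1 \<in> G1 \<and> g2 \<in> G2}"

definition prod_set :: "(complex^('n::finite)) set \<Rightarrow> (complex^('m::finite)) set \<Rightarrow> (complex^('n + 'm)) set" where
  "prod_set E1 E2 = {x. (\<chi> i. x $ Inl i) \<in> E1 \<and> (\<chi> i. x $ Inr i) \<in> E2}"

end

theory Submission
  imports Defs
begin

text \<open>
  A reflection of G1 \<times> G2 is a block matrix diag(h1, h2) whose fixed space Fix h1 \<times> Fix h2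
  is the kernel of a nonzero linear form; evaluating the form on vectors supported in one block
  shows that one of the two factors fixes everything. Hence the reflecting hyperplanes of the
  product are Y1 \<times> C^n2 and C^n1 \<times> Y2, and goodness of E1 \<times> E2 reduces to the stability
  of the slice conditions under products: the relative frontier of a product of slices is given by
  the product formula for frontiers, into which the conditions for the factors can be substituted
  because the frontier condition also identifies Y \<inter> closure E with the relative closure of Y \<inter> E.
\<close>

definition good_slice :: "'a::topological_space set \<Rightarrow> 'a set \<Rightarrow> bool" where
  "good_slice Y E \<longleftrightarrow>
     connected (Y \<inter> E) \<and> Y \<inter> frontier E = subtopology euclidean Y frontier_of (Y \<inter> E)"

lemma good_iff_good_slice:
  "good G E \<longleftrightarrow> bounded E \<and> domain E \<and> invariant G E \<and>
     (\<forall>Y\<in>reflecting_hyperplanes G. good_slice Y E)"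
  by (simp add: good_def good_slice_def)

lemma good_slice_UNIV: "connected E \<Longrightarrow> good_slice UNIV E"
  by (simp add: good_slice_def)

lemma frontier_of_Times:
  "prod_topology X Y frontier_of (S \<times> T) =
     (X frontier_of S) \<times> (Y closure_of T) \<union> (X closure_of S) \<times> (Y frontier_of T)"
  unfolding frontier_of_def closure_of_Times interior_of_Times
  using interior_of_subset_closure_of[of X S] interior_of_subset_closure_of[of Y T]
  by blast

lemma Int_closure_eq_closure_of_slice:
  assumes "Y \<inter> frontier E = subtopology euclidean Y frontier_of (Y \<inter> E)"
  shows "Y \<inter> closure E = subtopology euclidean Y closure_of (Y \<inter> E)"
proof -
  have "subtopology euclidean Y closure_of (Y \<inter> E) =
      (Y \<inter> E) \<union> subtopology euclidean Y frontier_of (Y \<inter> E)"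
    using closure_of_subset[of "Y \<inter> E" "subtopology euclidean Y"]
      interior_of_subset[of "subtopology euclidean Y" "Y \<inter> E"]
    by (auto simp: frontier_of_def)
  then show ?thesis
    using assms by (auto simp: closure_Un_frontier)
qed

lemma good_slice_Times:
  assumes "good_slice Y1 E1" "good_slice Y2 E2"
  shows "good_slice (Y1 \<times> Y2) (E1 \<times> E2)"
proof -
  let ?fr = "\<lambda>Y E. subtopology euclidean Y frontier_of (Y \<inter> E)"
  let ?cl = "\<lambda>Y E. subtopology euclidean Y closure_of (Y \<inter> E)"
  have "(Y1 \<times> Y2) \<inter> frontier (E1 \<times> E2) =
      (Y1 \<inter> frontier E1) \<times> (Y2 \<inter> closure E2) \<union> (Y1 \<inter> closure E1) \<times> (Y2 \<inter> frontier E2)"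
    using frontier_of_Times[of euclidean euclidean E1 E2] by auto
  also have "\<dots> = ?fr Y1 E1 \<times> ?cl Y2 E2 \<union> ?cl Y1 E1 \<times> ?fr Y2 E2"
    using assms Int_closure_eq_closure_of_slice[of Y1 E1] Int_closure_eq_closure_of_slice[of Y2 E2]
    by (simp add: good_slice_def)
  also have "\<dots> = ?fr (Y1 \<times> Y2) (E1 \<times> E2)"
    by (metis frontier_of_Times prod_topology_subtopology_eu Times_Int_Times)
  finally show ?thesis
    using assms by (simp add: good_slice_def Times_Int_Times connected_Times)
qed

lemma good_slice_homeomorphic_image:
  assumes f: "homeomorphic_map euclidean euclidean f" and "good_slice Y E"
  shows "good_slice (f ` Y) (f ` E)"
proof -
  have "inj f"
    using f homeomorphic_imp_injective_map by fastforce
  have "homeomorphic_map (subtopology euclidean Y) (subtopology euclidean (f ` Y)) f"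
    using f by (rule homeomorphic_map_subtopologies) simp
  then have "subtopology euclidean (f ` Y) frontier_of (f ` (Y \<inter> E)) =
      f ` (subtopology euclidean Y frontier_of (Y \<inter> E))"
    by (rule homeomorphic_map_frontier_of) auto
  moreover have "frontier (f ` E) = f ` frontier E"
    using homeomorphic_map_frontier_of[OF f, of E] by simp
  moreover have "connected (f ` (Y \<inter> E))"
    using assms homeomorphic_imp_continuous_map[OF f]
    by (auto simp: good_slice_def intro: connected_continuous_image continuous_on_subset)
  ultimately show ?thesis
    using assms by (simp add: good_slice_def image_Int[OF \<open>inj f\<close>, symmetric])
qed

definition vec_join :: "('a^'n::finite) \<times> ('a^'m::finite) \<Rightarrow> 'a^('n + 'm)" where
  "vec_join p = (\<chi> i. case i of Inl a \<Rightarrow> fst p $ a | Inr b \<Rightarrow> snd p $ b)"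

definition vec_split :: "'a^('n::finite + 'm::finite) \<Rightarrow> ('a^'n) \<times> ('a^'m)" where
  "vec_split x = ((\<chi> i. x $ Inl i), (\<chi> i. x $ Inr i))"

lemma vec_split_join [simp]: "vec_split (vec_join p) = p"
  by (simp add: vec_split_def vec_join_def vec_eq_iff)

lemma vec_join_split [simp]: "vec_join (vec_split x) = x"
  by (simp add: vec_split_def vec_join_def vec_eq_iff split: sum.split)

lemma vec_join_eq_iff [simp]: "vec_join p = vec_join q \<longleftrightarrow> p = q"
  by (metis vec_split_join)

lemma vec_join_zero [simp]: "vec_join (0, 0) = 0"
  by (simp add: vec_join_def vec_eq_iff split: sum.split)

lemma inj_vec_join: "inj vec_join"
  by (simp add: inj_def)

lemma vec_join_image_eq_vimage: "vec_join ` S = vec_split -` S"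
  by (auto simp: image_iff) (metis vec_join_split)

lemma prod_set_eq_vec_join_image: "prod_set E1 E2 = vec_join ` (E1 \<times> E2)"
  by (auto simp: prod_set_def vec_join_image_eq_vimage vec_split_def)

lemma bounded_linear_vec_join:
  "bounded_linear (vec_join :: ('a::euclidean_space^'n::finite) \<times> ('a^'m::finite) \<Rightarrow> _)"
  by (rule linear_conv_bounded_linear[THEN iffD1])
    (auto simp: linear_iff vec_eq_iff vec_join_def split: sum.split)

lemma bounded_linear_vec_split:
  "bounded_linear (vec_split :: 'a::euclidean_space^('n::finite + 'm::finite) \<Rightarrow> _)"
  by (rule linear_conv_bounded_linear[THEN iffD1])
    (auto simp: linear_iff vec_eq_iff vec_split_def)

lemma homeomorphic_map_vec_join:
  "homeomorphic_map euclidean euclidean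
     (vec_join :: ('a::euclidean_space^'n::finite) \<times> ('a^'m::finite) \<Rightarrow> _)"
  using bounded_linear_vec_join bounded_linear_vec_split
  by (auto simp: homeomorphic_map_maps homeomorphic_maps_def intro!: linear_continuous_on)

lemma sum_mult_vec_join:
  "(\<Sum>i\<in>UNIV. vec_join (a, b) $ i * vec_join (u, v) $ i) =
     (\<Sum>i\<in>UNIV. a $ i * u $ i) + (\<Sum>i\<in>UNIV. b $ i * (v $ i :: 'a::semiring_0))"
  by (simp add: vec_join_def sum.Plus flip: UNIV_Plus_UNIV)

lemma chyperplane_vec_join_Times:
  assumes "chyperplane (vec_join ` (F1 \<times> F2))"
  shows "chyperplane F1 \<and> F2 = UNIV \<or> F1 = UNIV \<and> chyperplane F2"
proof -
  obtain a where "a \<noteq> 0" and H: "vec_join ` (F1 \<times> F2) = {x. (\<Sum>i\<in>UNIV. a $ i * x $ i) = 0}"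
    using assms by (auto simp: chyperplane_def)
  obtain a1 a2 where a: "a = vec_join (a1, a2)"
    by (metis vec_join_split surj_pair)
  define \<phi>1 where "\<phi>1 u = (\<Sum>i\<in>UNIV. a1 $ i * u $ i)" for u
  define \<phi>2 where "\<phi>2 v = (\<Sum>i\<in>UNIV. a2 $ i * v $ i)" for v
  have mem: "u \<in> F1 \<and> v \<in> F2 \<longleftrightarrow> \<phi>1 u + \<phi>2 v = 0" for u v
  proof -
    have "u \<in> F1 \<and> v \<in> F2 \<longleftrightarrow> vec_join (u, v) \<in> vec_join ` (F1 \<times> F2)"
      using inj_vec_join by (auto simp: inj_image_mem_iff)
    then show ?thesis
      by (simp add: H a \<phi>1_def \<phi>2_def sum_mult_vec_join)
  qed
  have \<phi>_zero: "\<phi>1 0 = 0" "\<phi>2 0 = 0"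
    by (simp_all add: \<phi>1_def \<phi>2_def)
  have F1: "F1 = {u. \<phi>1 u = 0}" and F2: "F2 = {v. \<phi>2 v = 0}"
    using mem[of _ 0] mem[of 0] \<phi>_zero by auto
  have \<phi>_axis: "\<phi>1 (axis i c) = a1 $ i * c" "\<phi>2 (axis j c) = a2 $ j * c" for i j c
    by (simp_all add: \<phi>1_def \<phi>2_def axis_def if_distrib cong: if_cong)
  have "a1 = 0 \<or> a2 = 0"
  proof (rule ccontr)
    assume "\<not> (a1 = 0 \<or> a2 = 0)"
    then obtain i j where i: "a1 $ i \<noteq> 0" and j: "a2 $ j \<noteq> 0"
      by (auto simp: vec_eq_iff)
    \<comment> \<open>a vector off F1 completed by a second block to a vector of the hyperplane\<close>
    have "\<phi>1 (axis i 1) + \<phi>2 (axis j (- a1 $ i / a2 $ j)) = 0"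
      using j by (simp add: \<phi>_axis)
    then have "axis i 1 \<in> F1"
      using mem by blast
    then show False
      using i by (simp add: F1 \<phi>_axis)
  qed
  moreover have "a1 \<noteq> 0 \<or> a2 \<noteq> 0"
    using \<open>a \<noteq> 0\<close> a by auto
  ultimately show ?thesis
    by (auto simp: F1 F2 \<phi>1_def \<phi>2_def chyperplane_def)
qed

lemma block_diag_mult_vec_join:
  "block_diag g1 g2 *v vec_join (u, v) = vec_join (g1 *v u, g2 *v v)"
  by (simp add: vec_eq_iff vec_join_def block_diag_def matrix_vector_mult_def sum.Plus
      flip: UNIV_Plus_UNIV split: sum.split)

lemma block_diag_image_vec_join:
  "(*v) (block_diag g1 g2) ` vec_join ` (A \<times> B) = vec_join ` ((*v) g1 ` A \<times> (*v) g2 ` B)"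
  by (force simp: block_diag_mult_vec_join image_iff)

lemma fixset_block_diag: "fixset (block_diag g1 g2) = vec_join ` (fixset g1 \<times> fixset g2)"
proof -
  have "vec_join p \<in> fixset (block_diag g1 g2) \<longleftrightarrow> p \<in> fixset g1 \<times> fixset g2" for p
    by (cases p) (simp add: fixset_def block_diag_mult_vec_join)
  then show ?thesis
    by (metis (no_types) vec_join_image_eq_vimage vec_join_split vimage_eq set_eqI)
qed

lemma funpow_block_diag_vec_join:
  "((*v) (block_diag g1 g2) ^^ k) (vec_join (u, v)) =
     vec_join (((*v) g1 ^^ k) u, ((*v) g2 ^^ k) v)"
  by (induction k) (simp_all add: block_diag_mult_vec_join)

lemma reflection_block_diag_cases:
  assumes "reflection (block_diag h1 h2)" "unitary h1" "unitary h2"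
  shows "reflection h1 \<and> fixset h2 = UNIV \<or> fixset h1 = UNIV \<and> reflection h2"
proof -
  obtain k where "k > 0" and k: "(*v) (block_diag h1 h2) ^^ k = id"
    using assms(1) by (auto simp: reflection_def)
  have "((*v) h1 ^^ k) u = u \<and> ((*v) h2 ^^ k) v = v" for u v
    using funpow_block_diag_vec_join[of k h1 h2 u v] k by simp
  then have "(*v) h1 ^^ k = id" "(*v) h2 ^^ k = id"
    by (auto simp: fun_eq_iff)
  moreover have "chyperplane (vec_join ` (fixset h1 \<times> fixset h2))"
    using assms(1) by (simp add: reflection_def fixset_block_diag)
  ultimately show ?thesis
    using chyperplane_vec_join_Times assms(2,3) \<open>k > 0\<close> by (auto simp: reflection_def)
qed

lemma reflecting_hyperplane_prod_groupE [consumes 3]: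
  assumes "\<forall>g\<in>G1. unitary g" "\<forall>g\<in>G2. unitary g"
    and "Y \<in> reflecting_hyperplanes (prod_group G1 G2)"
  obtains (left) Y1 where "Y1 \<in> reflecting_hyperplanes G1" "Y = vec_join ` (Y1 \<times> UNIV)"
  | (right) Y2 where "Y2 \<in> reflecting_hyperplanes G2" "Y = vec_join ` (UNIV \<times> Y2)"
proof -
  obtain h1 h2 where h: "h1 \<in> G1" "h2 \<in> G2" "reflection (block_diag h1 h2)"
    and Y: "Y = vec_join ` (fixset h1 \<times> fixset h2)"
    using assms(3) by (auto simp: reflecting_hyperplanes_def prod_group_def fixset_block_diag)
  then consider "reflection h1" "fixset h2 = UNIV" | "fixset h1 = UNIV" "reflection h2"
    using reflection_block_diag_cases assms(1,2) by blast
  then show thesis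
  proof cases
    case 1
    then show thesis
      using left[of "fixset h1"] h Y by (auto simp: reflecting_hyperplanes_def)
  next
    case 2
    then show thesis
      using right[of "fixset h2"] h Y by (auto simp: reflecting_hyperplanes_def)
  qed
qed

lemma bounded_prod_set: "bounded E1 \<Longrightarrow> bounded E2 \<Longrightarrow> bounded (prod_set E1 E2)"
  by (simp add: prod_set_eq_vec_join_image bounded_linear_image bounded_linear_vec_join
      bounded_Times)

lemma domain_prod_set: "domain E1 \<Longrightarrow> domain E2 \<Longrightarrow> domain (prod_set E1 E2)"
  unfolding domain_def prod_set_eq_vec_join_image
  using homeomorphic_map_openness_eq[OF homeomorphic_map_vec_join, of "E1 \<times> E2"]
    linear_continuous_on[OF bounded_linear_vec_join]
  by (auto intro: connected_continuous_image connected_Times continuous_on_subset open_Times)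

lemma invariant_prod_group:
  "invariant G1 E1 \<Longrightarrow> invariant G2 E2 \<Longrightarrow> invariant (prod_group G1 G2) (prod_set E1 E2)"
  unfolding invariant_def prod_group_def prod_set_eq_vec_join_image
  by (clarsimp simp: block_diag_image_vec_join)

lemma good_slice_prod_set:
  "good_slice Y1 E1 \<Longrightarrow> good_slice Y2 E2 \<Longrightarrow>
     good_slice (vec_join ` (Y1 \<times> Y2)) (prod_set E1 E2)"
  by (simp add: prod_set_eq_vec_join_image good_slice_homeomorphic_image
      homeomorphic_map_vec_join good_slice_Times)

theorem proposition4p5:
  fixes G1 :: "('n::finite) cmat set" and G2 :: "('m::finite) cmat set"
    and E1 :: "(complex^'n) set" and E2 :: "(complex^'m) set"
  assumes "finite_unitary_reflection_group G1" and "finite_unitary_reflection_group G2"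
    and "good G1 E1" and "good G2 E2"
  shows "good (prod_group G1 G2) (prod_set E1 E2)"
proof -
  have unitary: "\<forall>g\<in>G1. unitary g" "\<forall>g\<in>G2. unitary g"
    using assms(1,2) by (simp_all add: finite_unitary_reflection_group_def)
  have "good_slice Y (prod_set E1 E2)"
    if "Y \<in> reflecting_hyperplanes (prod_group G1 G2)" for Y
    using unitary that assms(3,4)
    by (cases rule: reflecting_hyperplane_prod_groupE)
      (simp_all add: good_iff_good_slice domain_def good_slice_UNIV good_slice_prod_set)
  then show ?thesis
    using assms(3,4)
    by (simp add: good_iff_good_slice bounded_prod_set domain_prod_set invariant_prod_group)
qed

end
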